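(* Suppose that for all integers $n\geq1$, $m\geq2$ and all integers $\ell_a,\ell_b$ with $m^n\geq\ell_a\geq\ell_b>0$ the following holds: if $\ell_a+\ell_b\leq m^n$ then $|\Theta(Lex^{-1}(n,m;\ell_a+\ell_b))|+\sigma_{n,m}(\ell_a,\ell_b)\leq|\Theta(Lex^{-1}(n,m;\ell_a))|+|\Theta(Lex^{-1}(n,m;\ell_b))|$, and if $\ell_a+\ell_b\geq m^n$ then $|\Theta(Lex^{-1}(n,m;\ell_a+\ell_b-m^n))|+\sigma_{n,m}(\ell_a,\ell_b)\leq|\Theta(Lex^{-1}(n,m;\ell_a))|+|\Theta(Lex^{-1}(n,m;\ell_b))|$. Then for all integers $n\geq1$, $m\geq2$, $s,t\geq0$ with $s+t\leq m$, and all $0\leq\ell\leq m^n$, \[ \min\{|\Theta_{s,t}(S)|: S\subseteq\{0,\dots,m-1\}^n,\ |S|=\ell\}=|\Theta_{s,t}(Lex^{-1}(n,m;\ell))|. \]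
   Context: $S(n,m)$ ($n\geq1$, $m\geq2$) is the graph on $\{0,\dots,m-1\}^n$ in which distinct $u,v$ are adjacent iff there is $h\in\{1,\dots,n\}$ with $u_i=v_i$ for $i<h$, $u_h\neq v_h$, and $u_j=v_h$, $v_j=u_h$ for all $j>h$. $\Theta(S)$ is the set of edges of $S(n,m)$ with exactly one endpoint in $S$. $Lex(v)=1+\sum_{i=1}^n v_im^{n-i}$ and $Lex^{-1}(n,m;\ell)=\{v:Lex(v)\leq\ell\}$. Corner vertices are $i^n=(i,\dots,i)$; $q_{n,m}(\ell)$ is the number of corner vertices $v$ with $Lex(v)\leq\ell$. For $0\leq\ell_b\leq\ell_a\leq m^n$, $\sigma_{n,m}(\ell_a,\ell_b)=q_{n,m}(\ell_b)+q_{n,m}(\ell_a+\ell_b)-q_{n,m}(\ell_a)$ if $\ell_a+\ell_b<m^n$, and $=q_{n,m}(\ell_b)-q_{n,m}(\ell_a+\ell_b-m^n)+m-q_{n,m}(\ell_a)$ if $\ell_a+\ell_b\geq m^n$. Decorated graph: given $s+t\leq m$, let $I=\{0,\dots,s-1\}$, $J=\{s,\dots,s+t-1\}$, $K=\{s+t,\dots,m-1\}$; $S_{s,t}(n,m)$ is $S(n,m)$ with new exterior vertices $v_i$ ($i\in I\cup K$) and exterior edges $\{v_i,i^n\}$ ($i\in I\cup K$). For $S\subseteq\{0,\dots,m-1\}^n$, $\Theta_{s,t}(S)$ is the set of edges of $S_{s,t}(n,m)$ with exactly one endpoint in $S\cup\{v_i:i\in I\}$. *)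

theory Defs
  imports Main
begin

text \<open>
  Words over the alphabet \<open>{0, \<dots>, m - 1}\<close> are lists of naturals, so the coordinate \<open>v\<^sub>i\<close>
  (\<open>1 \<le> i \<le> n\<close>) is \<open>v ! (i - 1)\<close>.  Edges are unordered pairs, i.e. two-element sets of vertices.
\<close>

definition vertices :: "nat \<Rightarrow> nat \<Rightarrow> nat list set" where
  "vertices n m = {v. length v = n \<and> set v \<subseteq> {..<m}}"

definition adj :: "nat \<Rightarrow> nat list \<Rightarrow> nat list \<Rightarrow> bool" where
  "adj n u v \<longleftrightarrow>
     (\<exists>h<n. (\<forall>i<h. u ! i = v ! i) \<and> u ! h \<noteq> v ! h \<and>
            (\<forall>j. h < j \<and> j < n \<longrightarrow> u ! j = v ! h \<and> v ! j = u ! h))"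

definition edges :: "nat \<Rightarrow> nat \<Rightarrow> nat list set set" where
  "edges n m = {{u, v} | u v. u \<in> vertices n m \<and> v \<in> vertices n m \<and> u \<noteq> v \<and> adj n u v}"

definition edge_boundary :: "'a set set \<Rightarrow> 'a set \<Rightarrow> 'a set set" where
  "edge_boundary E S = {e \<in> E. card (e \<inter> S) = 1}"

definition Theta :: "nat \<Rightarrow> nat \<Rightarrow> nat list set \<Rightarrow> nat list set set" where
  "Theta n m S = edge_boundary (edges n m) S"

definition Lex :: "nat \<Rightarrow> nat \<Rightarrow> nat list \<Rightarrow> nat" where
  "Lex n m v = 1 + (\<Sum>i = 1..n. v ! (i - 1) * m ^ (n - i))"

definition Lex_inv :: "nat \<Rightarrow> nat \<Rightarrow> nat \<Rightarrow> nat list set" where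
  "Lex_inv n m l = {v \<in> vertices n m. Lex n m v \<le> l}"

definition corner :: "nat \<Rightarrow> nat \<Rightarrow> nat list" where
  "corner n i = replicate n i"

definition q :: "nat \<Rightarrow> nat \<Rightarrow> nat \<Rightarrow> nat" where
  "q n m l = card {v \<in> corner n ` {..<m}. Lex n m v \<le> l}"

definition sigma :: "nat \<Rightarrow> nat \<Rightarrow> nat \<Rightarrow> nat \<Rightarrow> int" where
  "sigma n m la lb =
     (if la + lb < m ^ n
      then int (q n m lb) + int (q n m (la + lb)) - int (q n m la)
      else int (q n m lb) - int (q n m (la + lb - m ^ n)) + int m - int (q n m la))"

text \<open>
  In the decorated graph \<open>Inl v\<close> is the vertex \<open>v\<close> of \<open>S(n,m)\<close> and \<open>Inr i\<close> is the exterior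
  vertex \<open>v\<^sub>i\<close>, where \<open>i \<in> I \<union> K\<close>.
\<close>

definition I_set :: "nat \<Rightarrow> nat set" where
  "I_set s = {..<s}"

definition K_set :: "nat \<Rightarrow> nat \<Rightarrow> nat \<Rightarrow> nat set" where
  "K_set m s t = {s + t..<m}"

definition dec_edges :: "nat \<Rightarrow> nat \<Rightarrow> nat \<Rightarrow> nat \<Rightarrow> (nat list + nat) set set" where
  "dec_edges n m s t =
     (image Inl) ` edges n m \<union>
     {{Inr i, Inl (corner n i)} | i. i \<in> I_set s \<union> K_set m s t}"

definition dec_Theta ::
  "nat \<Rightarrow> nat \<Rightarrow> nat \<Rightarrow> nat \<Rightarrow> nat list set \<Rightarrow> (nat list + nat) set set" where
  "dec_Theta n m s t S = edge_boundary (dec_edges n m s t) (Inl ` S \<union> Inr ` I_set s)"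

end

theory Submission
  imports Defs
begin

text \<open>
  \<open>S(n+1,m)\<close> consists of \<open>m\<close> copies of \<open>S(n,m)\<close>, with corner \<open>j\<close> of copy \<open>i\<close> joined to corner
  \<open>i\<close> of copy \<open>j\<close>. With the other copies fixed, the edges leaving one copy form a decoration of
  it, so by induction on \<open>n\<close> its part of \<open>S\<close> may be replaced by a lexicographic segment after a
  suitable relabelling of the alphabet. Two partially filled copies with \<open>la \<ge> lb\<close> vertices can then
  be merged by moving vertices from the second to the first until the second is empty or the first is
  full: \<open>sigma\<close> is exactly the number of corners whose membership changes, hence an upper bound for the
  increase in boundary edges between copies and at exterior vertices, and the hypothesis says that
  the boundaries inside the two copies drop by at least that much. At the end at most one copy is
  partially filled, and an elementary comparison shows that the lexicographic arrangement of the
  full copies is best.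
\<close>

section \<open>The cut as a set of ordered pairs\<close>

text \<open>Each boundary edge is listed once, oriented from inside to outside. Ordered pairs split
  by the first letters of their ends more easily than two-element sets.\<close>

definition cut :: "nat \<Rightarrow> nat \<Rightarrow> nat list set \<Rightarrow> (nat list \<times> nat list) set" where
  "cut n m A = {(u, v). u \<in> A \<and> v \<in> vertices n m - A \<and> adj n u v}"

definition bd :: "nat \<Rightarrow> nat \<Rightarrow> nat list set \<Rightarrow> nat" where
  "bd n m A = card (cut n m A)"

definition section_at :: "nat list set \<Rightarrow> nat \<Rightarrow> nat list set" where
  "section_at A i = {v. i # v \<in> A}"

lemma finite_vertices: "finite (vertices n m)"
  unfolding vertices_def using finite_lists_length_eq[of "{..<m}" n]
  by (simp add: conj_commute)

lemma card_vertices: "card (vertices n m) = m ^ n"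
  unfolding vertices_def using card_lists_length_eq[of "{..<m}" n]
  by (simp add: conj_commute)

lemma vertices_Suc_iff: "i # v \<in> vertices (Suc n) m \<longleftrightarrow> i < m \<and> v \<in> vertices n m"
  by (auto simp: vertices_def)

lemma vertices_Suc_E:
  assumes "w \<in> vertices (Suc n) m"
  obtains i v where "w = i # v" "i < m" "v \<in> vertices n m"
  using assms by (cases w) (auto simp: vertices_def)

lemma section_at_subset: "A \<subseteq> vertices (Suc n) m \<Longrightarrow> section_at A i \<subseteq> vertices n m"
  by (auto simp: section_at_def vertices_Suc_iff)

lemma corner_in_vertices: "i < m \<Longrightarrow> corner n i \<in> vertices n m"
  by (auto simp: corner_def vertices_def)

lemma corner_Suc: "corner (Suc n) i = i # corner n i"
  by (simp add: corner_def)

lemma inj_corner: "n \<ge> 1 \<Longrightarrow> inj (corner n)"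
  by (auto simp: corner_def inj_def)

lemma adj_sym:
  assumes "adj n u v"
  shows "adj n v u"
proof -
  obtain h where h: "h < n" "\<And>i. i < h \<Longrightarrow> u ! i = v ! i" "u ! h \<noteq> v ! h"
    "\<And>j. h < j \<Longrightarrow> j < n \<Longrightarrow> u ! j = v ! h" "\<And>j. h < j \<Longrightarrow> j < n \<Longrightarrow> v ! j = u ! h"
    using assms unfolding adj_def by blast
  show ?thesis
    unfolding adj_def
    by (rule exI[of _ h]) (simp add: h(1,2,4,5) h(3)[symmetric])
qed

text \<open>Equal first letters shift the deciding position by one. Different ones make position 0
  the deciding one, which forces every later letter, so two copies are joined by a single
  edge.\<close>

lemma adj_Cons:
  assumes "length u = n" "length v = n"
  shows "adj (Suc n) (i # u) (j # v) \<longleftrightarrow>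
    (if i = j then adj n u v else u = corner n j \<and> v = corner n i)"
proof (cases "i = j")
  case True
  have "adj (Suc n) (i # u) (i # v) \<longleftrightarrow> adj n u v"
  proof
    assume "adj (Suc n) (i # u) (i # v)"
    then obtain h where h: "h < Suc n" "\<forall>k<h. (i # u) ! k = (i # v) ! k"
      "(i # u) ! h \<noteq> (i # v) ! h"
      "\<forall>j. h < j \<and> j < Suc n \<longrightarrow> (i # u) ! j = (i # v) ! h \<and> (i # v) ! j = (i # u) ! h"
      unfolding adj_def by blast
    from h(3) obtain g where g: "h = Suc g" by (cases h) auto
    have "u ! k = v ! k" if "k < g" for k
      using h(2)[rule_format, of "Suc k"] g that by simp
    moreover have "u ! j = v ! g \<and> v ! j = u ! g" if "g < j" "j < n" for j
      using h(4)[rule_format, of "Suc j"] g that by simp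
    ultimately show "adj n u v" unfolding adj_def using h(1,3) g by (intro exI[of _ g]) simp
  next
    assume "adj n u v"
    then obtain g where g: "g < n" "\<forall>k<g. u ! k = v ! k" "u ! g \<noteq> v ! g"
      "\<forall>j. g < j \<and> j < n \<longrightarrow> u ! j = v ! g \<and> v ! j = u ! g"
      unfolding adj_def by blast
    show "adj (Suc n) (i # u) (i # v)"
      unfolding adj_def
    proof (intro exI[of _ "Suc g"] conjI allI impI)
      show "(i # u) ! k = (i # v) ! k" if "k < Suc g" for k
        using g(2)[rule_format, of "k - 1"] that by (cases k) simp_all
      show "(i # u) ! k = (i # v) ! Suc g" "(i # v) ! k = (i # u) ! Suc g"
        if "Suc g < k \<and> k < Suc n" for k
        using g(4)[rule_format, of "k - 1"] that by (cases k; simp)+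
    qed (use g(1,3) in simp_all)
  qed
  then show ?thesis using True by simp
next
  case False
  have "adj (Suc n) (i # u) (j # v) \<longleftrightarrow> (\<forall>k<n. u ! k = j \<and> v ! k = i)"
  proof
    assume "adj (Suc n) (i # u) (j # v)"
    then obtain h where h: "h < Suc n" "\<forall>k<h. (i # u) ! k = (j # v) ! k"
      "\<forall>k. h < k \<and> k < Suc n \<longrightarrow> (i # u) ! k = (j # v) ! h \<and> (j # v) ! k = (i # u) ! h"
      unfolding adj_def by blast
    have "h = 0" using h(2) False by (cases h) auto
    then have "u ! k = j \<and> v ! k = i" if "k < n" for k
      using h(3)[rule_format, of "Suc k"] that by simp
    then show "\<forall>k<n. u ! k = j \<and> v ! k = i" by blast
  next
    assume "\<forall>k<n. u ! k = j \<and> v ! k = i"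
    then show "adj (Suc n) (i # u) (j # v)"
      unfolding adj_def
      by (intro exI[of _ 0]) (use False in \<open>auto simp: nth_Cons split: nat.splits\<close>)
  qed
  also have "\<dots> \<longleftrightarrow> u = corner n j \<and> v = corner n i"
    using assms by (auto simp: corner_def list_eq_iff_nth_eq)
  finally show ?thesis using False by simp
qed

lemma finite_cut: "A \<subseteq> vertices n m \<Longrightarrow> finite (cut n m A)"
  by (rule finite_subset[of _ "vertices n m \<times> vertices n m"])
    (auto simp: cut_def finite_vertices)

lemma card_doubleton_Int_eq_1:
  assumes "u \<noteq> v"
  shows "card ({u, v} \<inter> S) = 1 \<longleftrightarrow> (u \<in> S) \<noteq> (v \<in> S)"
  using assms by (auto simp: Int_insert_left)

lemma card_Theta:
  assumes "A \<subseteq> vertices n m"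
  shows "card (Theta n m A) = bd n m A"
proof -
  have inj: "inj_on (\<lambda>(u, v). {u, v}) (cut n m A)"
    by (auto simp: inj_on_def cut_def doubleton_eq_iff)
  have "Theta n m A = (\<lambda>(u, v). {u, v}) ` cut n m A"
  proof (intro equalityI subsetI)
    fix e assume "e \<in> Theta n m A"
    then obtain u v where e: "e = {u, v}" "u \<in> vertices n m" "v \<in> vertices n m" "u \<noteq> v"
      "adj n u v" "card (e \<inter> A) = 1"
      by (auto simp: Theta_def edge_boundary_def edges_def)
    then have "(u \<in> A) \<noteq> (v \<in> A)" using card_doubleton_Int_eq_1[of u v A] by blast
    then have "(u, v) \<in> cut n m A \<or> (v, u) \<in> cut n m A"
      using e adj_sym by (auto simp: cut_def)
    then show "e \<in> (\<lambda>(u, v). {u, v}) ` cut n m A"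
      using e(1) by (auto simp: image_iff insert_commute)
  next
    fix e assume "e \<in> (\<lambda>(u, v). {u, v}) ` cut n m A"
    then obtain u v where e: "e = {u, v}" "u \<in> A" "v \<in> vertices n m" "v \<notin> A" "adj n u v"
      by (auto simp: cut_def)
    then have "u \<noteq> v" by auto
    then have "card (e \<inter> A) = 1" using e card_doubleton_Int_eq_1[of u v A] by blast
    then show "e \<in> Theta n m A"
      using e assms \<open>u \<noteq> v\<close> unfolding Theta_def edge_boundary_def edges_def by blast
  qed
  then show ?thesis using card_image[OF inj] by (simp add: bd_def)
qed

lemma bd_empty [simp]: "bd n m {} = 0"
  by (simp add: bd_def cut_def)

lemma bd_vertices [simp]: "bd n m (vertices n m) = 0"
  by (simp add: bd_def cut_def)

lemma sum_of_bool_card: "finite A \<Longrightarrow> (\<Sum>i\<in>A. of_bool (P i) :: nat) = card {i \<in> A. P i}"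
  by (simp add: of_bool_def sum.If_cases Int_def)

section \<open>Splitting a set and its boundary into the \<open>m\<close> copies\<close>

lemma card_by_sections:
  assumes "A \<subseteq> vertices (Suc n) m"
  shows "card A = (\<Sum>i<m. card (section_at A i))"
proof -
  have "A = (\<Union>i<m. Cons i ` section_at A i)"
  proof (intro equalityI subsetI)
    fix w assume w: "w \<in> A"
    then obtain i v where "w = i # v" "i < m" using assms vertices_Suc_E by blast
    then show "w \<in> (\<Union>i<m. Cons i ` section_at A i)" using w by (auto simp: section_at_def)
  qed (auto simp: section_at_def)
  also have "card \<dots> = (\<Sum>i<m. card (Cons i ` section_at A i))"
    by (rule card_UN_disjoint)
      (auto intro: finite_subset[OF section_at_subset[OF assms] finite_vertices])
  also have "\<dots> = (\<Sum>i<m. card (section_at A i))"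
    by (intro sum.cong refl card_image) (auto simp: inj_on_def)
  finally show ?thesis .
qed

text \<open>A boundary edge stays in one copy or is the single edge between two copies. The double
  sum runs over ordered pairs with the inside end in copy \<open>i\<close>, so each such edge counts
  once and the diagonal contributes nothing.\<close>

lemma bd_Suc:
  assumes "A \<subseteq> vertices (Suc n) m"
  shows "bd (Suc n) m A = (\<Sum>i<m. bd n m (section_at A i)) +
    (\<Sum>i<m. \<Sum>j<m. of_bool (corner n j \<in> section_at A i \<and> corner n i \<notin> section_at A j))"
proof -
  let ?C = "\<lambda>i. (\<lambda>(u, v). (i # u, i # v)) ` cut n m (section_at A i)"
  define D where "D = {(i, j). i < m \<and> j < m \<and> corner n j \<in> section_at A i
    \<and> corner n i \<notin> section_at A j}"
  let ?D = "(\<lambda>(i, j). (i # corner n j, j # corner n i)) ` D"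
  have fin: "finite (cut n m (section_at A i))" for i
    by (rule finite_cut[OF section_at_subset[OF assms]])
  have finD: "finite D"
    by (rule finite_subset[of _ "{..<m} \<times> {..<m}"]) (auto simp: D_def)
  have "cut (Suc n) m A = (\<Union>i<m. ?C i) \<union> ?D"
  proof (intro equalityI subsetI)
    fix e assume "e \<in> cut (Suc n) m A"
    then obtain i u j v where e: "e = (i # u, j # v)" "i < m" "j < m" "u \<in> vertices n m"
      "v \<in> vertices n m" "i # u \<in> A" "j # v \<notin> A" "adj (Suc n) (i # u) (j # v)"
    proof -
      obtain w w' where w: "e = (w, w')" "w \<in> A" "w' \<in> vertices (Suc n) m" "w' \<notin> A" "adj (Suc n) w w'"
        using \<open>e \<in> cut (Suc n) m A\<close> by (auto simp: cut_def)
      obtain i u where "w = i # u" "i < m" "u \<in> vertices n m"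
        using vertices_Suc_E w(2) assms by blast
      moreover obtain j v where "w' = j # v" "j < m" "v \<in> vertices n m"
        using vertices_Suc_E w(3) by blast
      ultimately show ?thesis using that w by blast
    qed
    have len: "length u = n" "length v = n" using e by (auto simp: vertices_def)
    show "e \<in> (\<Union>i<m. ?C i) \<union> ?D"
    proof (cases "i = j")
      case True
      then have "(u, v) \<in> cut n m (section_at A i)"
        using e adj_Cons[OF len] by (auto simp: cut_def section_at_def)
      then have "e \<in> ?C i" using e(1) True by (auto intro!: image_eqI[of _ _ "(u, v)"])
      then show ?thesis using e(2) by blast
    next
      case False
      then have "u = corner n j" "v = corner n i" using e adj_Cons[OF len] by auto
      then have "(i, j) \<in> D" "e = (i # corner n j, j # corner n i)"
        using e by (auto simp: D_def section_at_def)
      then have "e \<in> ?D" by (auto intro!: image_eqI[of _ _ "(i, j)"])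
      then show ?thesis by blast
    qed
  next
    fix e assume "e \<in> (\<Union>i<m. ?C i) \<union> ?D"
    then show "e \<in> cut (Suc n) m A"
    proof
      assume "e \<in> (\<Union>i<m. ?C i)"
      then obtain i u v where e: "i < m" "e = (i # u, i # v)" "(u, v) \<in> cut n m (section_at A i)"
        by auto
      then have "u \<in> vertices n m" "v \<in> vertices n m"
        using section_at_subset[OF assms] by (auto simp: cut_def)
      then show ?thesis using e
        by (auto simp: cut_def section_at_def vertices_Suc_iff vertices_def adj_Cons)
    next
      assume "e \<in> ?D"
      then obtain i j where e: "(i, j) \<in> D" "e = (i # corner n j, j # corner n i)" by auto
      then have "i \<noteq> j" by (auto simp: D_def)
      moreover have "length (corner n j) = n" "length (corner n i) = n" by (auto simp: corner_def)
      ultimately show ?thesis using e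
        by (auto simp: cut_def D_def section_at_def vertices_Suc_iff adj_Cons corner_in_vertices)
    qed
  qed
  moreover have "(\<Union>i<m. ?C i) \<inter> ?D = {}"
    by (auto simp: D_def)
  ultimately have "bd (Suc n) m A = card (\<Union>i<m. ?C i) + card ?D"
    unfolding bd_def using fin finD by (simp add: card_Un_disjoint)
  moreover have "card (\<Union>i<m. ?C i) = (\<Sum>i<m. card (?C i))"
    by (rule card_UN_disjoint) (use fin in auto)
  moreover have "card (?C i) = bd n m (section_at A i)" for i
    unfolding bd_def by (rule card_image) (auto simp: inj_on_def)
  moreover have "card ?D = card D" by (rule card_image) (auto simp: inj_on_def)
  moreover have "card D = (\<Sum>i<m. \<Sum>j<m. of_bool (corner n j \<in> section_at A i \<and> corner n i \<notin> section_at A j))"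
  proof -
    have "D = (SIGMA i:{..<m}. {j\<in>{..<m}. corner n j \<in> section_at A i \<and> corner n i \<notin> section_at A j})"
      by (auto simp: D_def)
    then show ?thesis by (simp add: Int_def)
  qed
  ultimately show ?thesis by simp
qed

section \<open>Initial segments of the lexicographic order\<close>

lemma Lex_Nil: "Lex 0 m v = 1"
  by (simp add: Lex_def)

lemma Lex_Cons: "Lex (Suc n) m (i # v) = i * m ^ n + Lex n m v"
proof -
  have "(\<Sum>k = 1..Suc n. (i # v) ! (k - 1) * m ^ (Suc n - k))
    = i * m ^ n + (\<Sum>k = 2..Suc n. (i # v) ! (k - 1) * m ^ (Suc n - k))"
    by (subst sum.atLeast_Suc_atMost) (auto simp: numeral_2_eq_2)
  also have "(\<Sum>k = 2..Suc n. (i # v) ! (k - 1) * m ^ (Suc n - k))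
    = (\<Sum>k = 1..n. v ! (k - 1) * m ^ (n - k))"
    unfolding numeral_2_eq_2 sum.atLeast_Suc_atMost_Suc_shift
    by (rule sum.cong) (auto simp: nth_Cons')
  finally show ?thesis by (simp add: Lex_def)
qed

lemma Lex_pos: "1 \<le> Lex n m v"
  by (simp add: Lex_def)

lemma Lex_le: "v \<in> vertices n m \<Longrightarrow> Lex n m v \<le> m ^ n"
proof (induction n arbitrary: v)
  case 0
  then show ?case by (simp add: Lex_Nil)
next
  case (Suc n)
  then obtain i w where w: "v = i # w" "i < m" "w \<in> vertices n m" by (auto elim: vertices_Suc_E)
  have "Suc i * m ^ n \<le> m * m ^ n" using w by (intro mult_right_mono) auto
  then show ?case using w Suc.IH[of w] by (simp add: Lex_Cons)
qed

lemma Lex_inv_subset: "Lex_inv n m l \<subseteq> vertices n m"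
  by (auto simp: Lex_inv_def)

lemma Lex_inv_0 [simp]: "Lex_inv n m 0 = {}"
  by (simp add: Lex_inv_def Lex_def)

lemma Lex_inv_full: "m ^ n \<le> l \<Longrightarrow> Lex_inv n m l = vertices n m"
  using Lex_le by (fastforce simp: Lex_inv_def)

text \<open>Truncated subtraction serves all copies at once: past the end of the segment the level
  is 0, which gives the empty set since \<open>Lex\<close> starts at 1, and a level of at least
  \<open>m ^ n\<close> gives the whole copy.\<close>

lemma section_Lex_inv:
  "i < m \<Longrightarrow> section_at (Lex_inv (Suc n) m l) i = Lex_inv n m (l - i * m ^ n)"
  using Lex_pos[of n m]
  by (auto simp: section_at_def Lex_inv_def vertices_Suc_iff Lex_Cons le_diff_conv2 add.commute)
    (metis diff_is_0_eq le_diff_conv2 nle_le not_less_eq_eq)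

lemma card_Lex_inv: "l \<le> m ^ n \<Longrightarrow> card (Lex_inv n m l) = l"
proof (induction n arbitrary: l)
  case 0
  then consider "l = 0" | "l = 1" by fastforce
  then show ?case
    using card_vertices[of 0 m] by cases (simp_all add: Lex_inv_full)
next
  case (Suc n)
  let ?N = "m ^ n"
  have card_min: "card (Lex_inv n m k) = min k ?N" for k
    using Suc.IH[of k] by (cases "k \<le> ?N") (simp_all add: Lex_inv_full card_vertices)
  have "(\<Sum>i<k. min (l - i * ?N) ?N) = min l (k * ?N)" for k
    by (induction k) auto
  then have "(\<Sum>i<m. min (l - i * ?N) ?N) = l" using Suc.prems by simp
  then show ?case
    by (subst card_by_sections[OF Lex_inv_subset])
      (simp add: section_Lex_inv card_min)
qed

text \<open>Unlike \<open>q\<close>, this counts indices: for \<open>n = 0\<close> all \<open>m\<close> corners coincide, and counting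
  them separately allows the induction to start at \<open>n = 0\<close>.\<close>

definition corner_count :: "nat \<Rightarrow> nat \<Rightarrow> nat \<Rightarrow> nat" where
  "corner_count n m l = card {i. i < m \<and> Lex n m (corner n i) \<le> l}"

lemma q_eq_corner_count:
  assumes "n \<ge> 1"
  shows "q n m l = corner_count n m l"
proof -
  have "{v \<in> corner n ` {..<m}. Lex n m v \<le> l} = corner n ` {i. i < m \<and> Lex n m (corner n i) \<le> l}"
    by auto
  then show ?thesis
    using card_image[OF inj_on_subset[OF inj_corner[OF assms] subset_UNIV]]
    by (simp add: q_def corner_count_def)
qed

lemma down_closed_eq_lessThan:
  fixes D :: "nat set"
  assumes "finite D" "\<And>i j. j \<in> D \<Longrightarrow> i < j \<Longrightarrow> i \<in> D"
  shows "D = {..<card D}"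
proof (rule sym, rule card_subset_eq)
  show "{..<card D} \<subseteq> D"
  proof (rule ccontr)
    assume "\<not> {..<card D} \<subseteq> D"
    then obtain i where i: "i < card D" "i \<notin> D" by auto
    then have "D \<subseteq> {..<i}" using assms(2) by (metis lessThan_iff linorder_neqE_nat subsetI)
    then have "card D \<le> i" using card_mono[of "{..<i}" D] by simp
    then show False using i by simp
  qed
qed (use assms in auto)

lemma Lex_corner_mono: "i \<le> j \<Longrightarrow> Lex n m (corner n i) \<le> Lex n m (corner n j)"
  by (auto simp: Lex_def corner_def intro!: sum_mono)

text \<open>\<open>Lex\<close> is monotone along the corners, so a segment contains the corners of
  an initial part of the alphabet, and their number determines which ones.\<close>

lemma corner_in_Lex_inv_iff:
  assumes "i < m"
  shows "corner n i \<in> Lex_inv n m l \<longleftrightarrow> i < corner_count n m l"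
proof -
  let ?D = "{i. i < m \<and> Lex n m (corner n i) \<le> l}"
  have "?D = {..<card ?D}"
    by (rule down_closed_eq_lessThan) (auto intro: order.trans[OF Lex_corner_mono[OF less_imp_le]])
  then have "i \<in> ?D \<longleftrightarrow> i < card ?D" by blast
  then show ?thesis
    using assms by (simp add: Lex_inv_def corner_count_def corner_in_vertices)
qed

lemma corner_count_le: "corner_count n m l \<le> m"
  using card_mono[of "{..<m}" "{i. i < m \<and> Lex n m (corner n i) \<le> l}"]
  by (auto simp: corner_count_def)

lemma corner_count_0: "corner_count n m 0 = 0"
  by (simp add: corner_count_def Lex_def)

lemma corner_count_full: "corner_count n m (m ^ n) = m"
  using Lex_le[OF corner_in_vertices[of _ m n]] by (simp add: corner_count_def cong: conj_cong)

lemma corner_count_mono: "l \<le> l' \<Longrightarrow> corner_count n m l \<le> corner_count n m l'"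
  unfolding corner_count_def by (rule card_mono) auto

section \<open>Decorated boundary\<close>

text \<open>The corners in \<open>I\<close> have an outer neighbour inside the set, those in \<open>K\<close> one outside it.\<close>

definition cost :: "nat \<Rightarrow> nat \<Rightarrow> nat list set \<Rightarrow> nat set \<Rightarrow> nat set \<Rightarrow> nat" where
  "cost n m A I K = bd n m A + card {i \<in> I. corner n i \<notin> A} + card {i \<in> K. corner n i \<in> A}"

text \<open>The truncated differences count the corners of \<open>{..<s}\<close> outside a lexicographic segment and
  the corners of \<open>{m - k..<m}\<close> inside it.\<close>

definition lexcost :: "nat \<Rightarrow> nat \<Rightarrow> nat \<Rightarrow> nat \<Rightarrow> nat \<Rightarrow> nat" where
  "lexcost n m l s k = bd n m (Lex_inv n m l) + (s - corner_count n m l)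
     + (corner_count n m l + k - m)"

text \<open>An index lies in at most one of \<open>I\<close> and \<open>K\<close>, so each corner
  whose membership changes affects at most one exterior edge.\<close>

lemma cost_change_le:
  assumes "I \<subseteq> {..<m}" "K \<subseteq> {..<m}" "I \<inter> K = {}"
  shows "cost n m B I K + bd n m A \<le> cost n m A I K + bd n m B
    + card {i. i < m \<and> (corner n i \<in> A) \<noteq> (corner n i \<in> B)}"
proof -
  let ?D = "{i. i < m \<and> (corner n i \<in> A) \<noteq> (corner n i \<in> B)}"
  have fin: "finite I" "finite K" using assms finite_subset by blast+
  have "card {i \<in> I. corner n i \<notin> B} \<le> card ({i \<in> I. corner n i \<notin> A} \<union> (?D \<inter> I))"
    using assms fin by (intro card_mono) auto
  then have 1: "card {i \<in> I. corner n i \<notin> B} \<le> card {i \<in> I. corner n i \<notin> A} + card (?D \<inter> I)"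
    using card_Un_le order.trans by blast
  have "card {i \<in> K. corner n i \<in> B} \<le> card ({i \<in> K. corner n i \<in> A} \<union> (?D \<inter> K))"
    using assms fin by (intro card_mono) auto
  then have 2: "card {i \<in> K. corner n i \<in> B} \<le> card {i \<in> K. corner n i \<in> A} + card (?D \<inter> K)"
    using card_Un_le order.trans by blast
  have "card (?D \<inter> I) + card (?D \<inter> K) = card (?D \<inter> I \<union> ?D \<inter> K)"
    using assms fin by (subst card_Un_disjoint) auto
  also have "\<dots> \<le> card ?D" by (rule card_mono) auto
  finally show ?thesis using 1 2 by (simp add: cost_def)
qed

section \<open>Relabelling the alphabet\<close>

lemma inj_on_map_vertices:
  assumes "inj_on p {..<m}"
  shows "inj_on (map p) (vertices n m)"
proof (rule inj_onI)
  fix u v assume h: "u \<in> vertices n m" "v \<in> vertices n m" "map p u = map p v"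
  then have "inj_on p (set u \<union> set v)" by (intro inj_on_subset[OF assms]) (auto simp: vertices_def)
  then show "u = v" using h(3) by (simp add: inj_on_map_eq_map)
qed

lemma vertices_map:
  assumes "bij_betw p {..<m} {..<m}"
  shows "map p ` vertices n m = vertices n m"
proof (rule card_subset_eq[OF finite_vertices])
  show "map p ` vertices n m \<subseteq> vertices n m"
    using bij_betwE[OF assms] by (fastforce simp: vertices_def)
  show "card (map p ` vertices n m) = card (vertices n m)"
    by (rule card_image[OF inj_on_map_vertices[OF bij_betw_imp_inj_on[OF assms]]])
qed

text \<open>Adjacency mentions letters only through equations between them, so an injective
  relabelling preserves and reflects it.\<close>

lemma adj_map_iff:
  assumes "inj_on p {..<m}" "u \<in> vertices n m" "v \<in> vertices n m"
  shows "adj n (map p u) (map p v) \<longleftrightarrow> adj n u v"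
proof -
  have mem: "u ! i < m" "v ! i < m" if "i < n" for i
    using assms that by (auto simp: vertices_def subset_iff)
  have len: "length u = n" "length v = n" using assms by (auto simp: vertices_def)
  have eq: "map p u ! i = map p v ! j \<longleftrightarrow> u ! i = v ! j"
    "map p v ! i = map p u ! j \<longleftrightarrow> v ! i = u ! j" if "i < n" "j < n" for i j
    using that len mem assms(1) by (auto simp: inj_on_def)
  show ?thesis unfolding adj_def
    by (intro ex_cong1 conj_cong refl) (auto simp: eq)
qed

lemma bd_map:
  assumes p: "bij_betw p {..<m} {..<m}" and A: "A \<subseteq> vertices n m"
  shows "bd n m (map p ` A) = bd n m A"
proof -
  have inj: "inj_on p {..<m}" using p by (rule bij_betw_imp_inj_on)
  have V: "map p ` vertices n m = vertices n m" by (rule vertices_map[OF p])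
  have injV: "inj_on (map p) (vertices n m)" by (rule inj_on_map_vertices[OF bij_betw_imp_inj_on[OF p]])
  have "cut n m (map p ` A) = (\<lambda>(u, v). (map p u, map p v)) ` cut n m A"
  proof (intro equalityI subsetI)
    fix e assume "e \<in> cut n m (map p ` A)"
    then obtain u w where e: "e = (map p u, w)" "u \<in> A" "w \<in> vertices n m" "w \<notin> map p ` A"
      "adj n (map p u) w" by (auto simp: cut_def)
    then obtain v where v: "v \<in> vertices n m" "w = map p v" using V by blast
    then have "(u, v) \<in> cut n m A"
      using e A adj_map_iff[OF inj, of u n v] by (auto simp: cut_def)
    then show "e \<in> (\<lambda>(u, v). (map p u, map p v)) ` cut n m A"
      using e v by (auto intro!: image_eqI[of _ _ "(u, v)"])
  next
    fix e assume "e \<in> (\<lambda>(u, v). (map p u, map p v)) ` cut n m A"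
    then obtain u v where e: "e = (map p u, map p v)" "u \<in> A" "v \<in> vertices n m" "v \<notin> A"
      "adj n u v" by (auto simp: cut_def)
    have "map p v \<notin> map p ` A" using e A injV by (auto simp: inj_on_def)
    moreover have "map p v \<in> vertices n m" using V e by blast
    ultimately show "e \<in> cut n m (map p ` A)"
      using e A adj_map_iff[OF inj, of u n v] by (auto simp: cut_def)
  qed
  moreover have "inj_on (\<lambda>(u, v). (map p u, map p v)) (cut n m A)"
  proof (rule inj_onI, clarify)
    fix u v u' v' assume h: "(u, v) \<in> cut n m A" "(u', v') \<in> cut n m A"
      "map p u = map p u'" "map p v = map p v'"
    then have "u \<in> vertices n m" "v \<in> vertices n m" "u' \<in> vertices n m" "v' \<in> vertices n m"
      using A by (auto simp: cut_def)
    then show "u = u' \<and> v = v'" using h(3,4) injV by (meson inj_onD)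
  qed
  ultimately show ?thesis unfolding bd_def by (simp add: card_image)
qed

lemma corner_in_map_iff:
  assumes p: "bij_betw p {..<m} {..<m}" and A: "A \<subseteq> vertices n m" and i: "i < m"
  shows "corner n (p i) \<in> map p ` A \<longleftrightarrow> corner n i \<in> A"
proof -
  have "corner n (p i) = map p (corner n i)" by (simp add: corner_def)
  then show ?thesis
    using inj_on_image_mem_iff[OF inj_on_map_vertices[OF bij_betw_imp_inj_on[OF p]] corner_in_vertices[OF i] A] by simp
qed

lemma card_corner_map:
  assumes p: "bij_betw p {..<m} {..<m}" and A: "A \<subseteq> vertices n m" "B \<subseteq> vertices n m"
  shows "card {i. i < m \<and> (corner n i \<in> map p ` A) \<noteq> (corner n i \<in> map p ` B)}
    = card {i. i < m \<and> (corner n i \<in> A) \<noteq> (corner n i \<in> B)}"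
proof -
  have "bij_betw p {i. i < m \<and> (corner n i \<in> A) \<noteq> (corner n i \<in> B)}
    {i. i < m \<and> (corner n i \<in> map p ` A) \<noteq> (corner n i \<in> map p ` B)}"
    unfolding bij_betw_def
  proof
    show "inj_on p {i. i < m \<and> (corner n i \<in> A) \<noteq> (corner n i \<in> B)}"
      by (rule inj_on_subset[OF bij_betw_imp_inj_on[OF p]]) auto
    show "p ` {i. i < m \<and> (corner n i \<in> A) \<noteq> (corner n i \<in> B)} =
      {i. i < m \<and> (corner n i \<in> map p ` A) \<noteq> (corner n i \<in> map p ` B)}" (is "?L = ?R")
    proof (intro equalityI subsetI)
      fix j assume "j \<in> ?L"
      then obtain i where "i < m" "j = p i" "(corner n i \<in> A) \<noteq> (corner n i \<in> B)" by auto
      then show "j \<in> ?R"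
        using bij_betwE[OF p] corner_in_map_iff[OF p A(1)] corner_in_map_iff[OF p A(2)] by simp
    next
      fix j assume j: "j \<in> ?R"
      then obtain i where "i < m" "j = p i" using p unfolding bij_betw_def by blast
      then show "j \<in> ?L"
        using j corner_in_map_iff[OF p A(1)] corner_in_map_iff[OF p A(2)] by simp
    qed
  qed
  then show ?thesis by (rule bij_betw_same_card[symmetric])
qed

text \<open>A lexicographic segment takes corners in alphabetical order. Moving \<open>I\<close> to
  the front and \<open>K\<close> to the back makes it reach corners with a neighbour inside first
  and those with a neighbour outside last.\<close>

lemma exists_relabelling:
  assumes "I \<subseteq> {..<m}" "K \<subseteq> {..<m}" "I \<inter> K = {}"
  obtains p where "bij_betw p {..<m} {..<m}" "p ` {..<card I} = I" "p ` {m - card K..<m} = K"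
proof -
  have fin: "finite I" "finite K" using assms finite_subset by blast+
  have "card I + card K = card (I \<union> K)" using assms fin by (simp add: card_Un_disjoint)
  also have "\<dots> \<le> m" using card_mono[of "{..<m}" "I \<union> K"] assms by simp
  finally have le: "card I + card K \<le> m" .
  let ?J = "{..<m} - I - K" and ?s = "card I" and ?k = "card K"
  have cJ: "card ?J = m - ?k - ?s"
  proof -
    have "?J = {..<m} - (I \<union> K)" by auto
    also have "card \<dots> = m - card (I \<union> K)"
      using assms(1,2) fin by (subst card_Diff_subset) auto
    finally show ?thesis using \<open>card I + card K = card (I \<union> K)\<close> by simp
  qed
  obtain f where f: "bij_betw f {..<?s} I"
    using finite_same_card_bij[of "{..<?s}" I] fin by auto
  obtain g where g: "bij_betw g {?s..<m - ?k} ?J"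
    using finite_same_card_bij[of "{?s..<m - ?k}" ?J] cJ by auto
  obtain h where h: "bij_betw h {m - ?k..<m} K"
    using finite_same_card_bij[of "{m - ?k..<m}" K] fin le by auto
  define p where "p i = (if i < ?s then f i else if i < m - ?k then g i else h i)" for i
  have 1: "bij_betw p {..<?s} I" using f by (rule bij_betw_cong[THEN iffD1, rotated]) (simp add: p_def)
  have 2: "bij_betw p {?s..<m - ?k} ?J" using g by (rule bij_betw_cong[THEN iffD1, rotated]) (simp add: p_def)
  have 3: "bij_betw p {m - ?k..<m} K" using h by (rule bij_betw_cong[THEN iffD1, rotated]) (use le in \<open>auto simp: p_def\<close>)
  have "bij_betw p ({..<?s} \<union> {?s..<m - ?k} \<union> {m - ?k..<m}) (I \<union> ?J \<union> K)"
    using assms by (intro bij_betw_combine 1 2 3) auto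
  moreover have "{..<?s} \<union> {?s..<m - ?k} \<union> {m - ?k..<m} = {..<m}" using le by auto
  moreover have "I \<union> ?J \<union> K = {..<m}" using assms by auto
  ultimately show ?thesis using that 1 3 by (auto simp: bij_betw_def)
qed

lemma cost_Lex_map:
  assumes p: "bij_betw p {..<m} {..<m}" and "s \<le> m" "k \<le> m"
  shows "cost n m (map p ` Lex_inv n m l) (p ` {..<s}) (p ` {m - k..<m}) = lexcost n m l s k"
proof -
  let ?c = "corner_count n m l"
  \<comment> \<open>Only this comparison with \<open>?c\<close> matters: the corners whose exterior
    edge is cut become the images of \<open>{?c..<s}\<close> and
    \<open>{m - k..<?c}\<close>.\<close>
  have mem: "corner n (p i) \<in> map p ` Lex_inv n m l \<longleftrightarrow> i < ?c" if "i < m" for i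
    using corner_in_map_iff[OF p Lex_inv_subset that] corner_in_Lex_inv_iff[OF that] by blast
  have inj: "inj_on p {..<m}" using p by (rule bij_betw_imp_inj_on)
  have "{i \<in> p ` {..<s}. corner n i \<notin> map p ` Lex_inv n m l} = p ` {?c..<s}"
  proof -
    have "{i \<in> p ` {..<s}. corner n i \<notin> map p ` Lex_inv n m l}
      = p ` {i \<in> {..<s}. corner n (p i) \<notin> map p ` Lex_inv n m l}" by blast
    also have "{i \<in> {..<s}. corner n (p i) \<notin> map p ` Lex_inv n m l} = {?c..<s}"
      using mem assms(2) by (simp add: set_eq_iff) (metis linorder_not_le order_less_le_trans)
    finally show ?thesis .
  qed
  moreover have "card (p ` {?c..<s}) = s - ?c"
    using assms(2) by (subst card_image) (auto intro: inj_on_subset[OF inj])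
  moreover have "{i \<in> p ` {m - k..<m}. corner n i \<in> map p ` Lex_inv n m l} = p ` {m - k..<?c}"
  proof -
    have "{i \<in> p ` {m - k..<m}. corner n i \<in> map p ` Lex_inv n m l}
      = p ` {i \<in> {m - k..<m}. corner n (p i) \<in> map p ` Lex_inv n m l}" by blast
    also have "{i \<in> {m - k..<m}. corner n (p i) \<in> map p ` Lex_inv n m l} = {m - k..<?c}"
      using mem corner_count_le[of n m l]
      by (simp add: set_eq_iff) (metis order_less_le_trans)
    finally show ?thesis .
  qed
  moreover have "card (p ` {m - k..<?c}) = ?c + k - m"
    using assms(3) corner_count_le[of n m l] by (subst card_image) (auto intro: inj_on_subset[OF inj])
  ultimately show ?thesis
    by (simp add: cost_def lexcost_def bd_map[OF p Lex_inv_subset])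
qed

section \<open>Assembling the copies\<close>

text \<open>The cost on \<open>S(n+1,m)\<close> of the set whose part in copy \<open>i\<close> is
  \<open>F i\<close>; a family of sections allows one copy to be exchanged by function update. The
  exterior edge with index \<open>i\<close> sits at corner \<open>i\<close> of copy
  \<open>i\<close>.\<close>

definition fcost :: "nat \<Rightarrow> nat \<Rightarrow> (nat \<Rightarrow> nat list set) \<Rightarrow> nat set \<Rightarrow> nat set \<Rightarrow> nat" where
  "fcost n m F I K = (\<Sum>i<m. bd n m (F i))
     + (\<Sum>i<m. \<Sum>j<m. of_bool (corner n j \<in> F i \<and> corner n i \<notin> F j))
     + (\<Sum>i\<in>I. of_bool (corner n i \<notin> F i)) + (\<Sum>i\<in>K. of_bool (corner n i \<in> F i))"

definition frest :: "nat \<Rightarrow> nat \<Rightarrow> (nat \<Rightarrow> nat list set) \<Rightarrow> nat set \<Rightarrow> nat set \<Rightarrow> nat \<Rightarrow> nat" where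
  "frest n m F I K a = (\<Sum>i\<in>{..<m} - {a}. bd n m (F i))
     + (\<Sum>i\<in>{..<m} - {a}. \<Sum>j\<in>{..<m} - {a}. of_bool (corner n j \<in> F i \<and> corner n i \<notin> F j))
     + (\<Sum>i\<in>I - {a}. of_bool (corner n i \<notin> F i)) + (\<Sum>i\<in>K - {a}. of_bool (corner n i \<in> F i))"

text \<open>The decoration that the other copies induce on copy \<open>a\<close>: its corner
  \<open>j\<close> is joined to corner \<open>a\<close> of copy \<open>j\<close>, which acts as an
  exterior vertex. Corner \<open>a\<close> has no such neighbour and inherits the status of index
  \<open>a\<close> in \<open>I\<close>; \<open>outer\<close> is the counterpart with
  \<open>K\<close>.\<close>

definition inner :: "nat \<Rightarrow> nat \<Rightarrow> (nat \<Rightarrow> nat list set) \<Rightarrow> nat set \<Rightarrow> nat \<Rightarrow> nat set" where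
  "inner n m F I a = {j \<in> {..<m} - {a}. corner n a \<in> F j} \<union> I \<inter> {a}"

definition outer :: "nat \<Rightarrow> nat \<Rightarrow> (nat \<Rightarrow> nat list set) \<Rightarrow> nat set \<Rightarrow> nat \<Rightarrow> nat set" where
  "outer n m F K a = {j \<in> {..<m} - {a}. corner n a \<notin> F j} \<union> K \<inter> {a}"

lemma inner_outer:
  fixes F :: "nat \<Rightarrow> nat list set"
  assumes "a < m" "I \<inter> K = {}"
  shows "inner n m F I a \<subseteq> {..<m}" "outer n m F K a \<subseteq> {..<m}"
    "inner n m F I a \<inter> outer n m F K a = {}"
  using assms by (auto simp: inner_def outer_def)

lemma cost_Suc:
  assumes "A \<subseteq> vertices (Suc n) m" "finite I" "finite K"
  shows "cost (Suc n) m A I K = fcost n m (section_at A) I K"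
  using assms by (simp add: cost_def fcost_def bd_Suc corner_Suc section_at_def Int_def)

lemma card_Collect_Un_singleton:
  assumes "finite X" "a \<notin> X"
  shows "card {i \<in> X \<union> K \<inter> {a}. P i} = card {i \<in> X. P i} + of_bool (a \<in> K \<and> P a)"
proof (cases "a \<in> K \<and> P a")
  case True
  then have "{i \<in> X \<union> K \<inter> {a}. P i} = insert a {i \<in> X. P i}" by auto
  then show ?thesis using assms True by simp
next
  case False
  then have "{i \<in> X \<union> K \<inter> {a}. P i} = {i \<in> X. P i}" by auto
  then show ?thesis using False by simp
qed

lemma sum_remove_of_bool:
  assumes "finite I"
  shows "(\<Sum>i\<in>I. of_bool (P i) :: nat) = (\<Sum>i\<in>I - {a}. of_bool (P i)) + of_bool (a \<in> I \<and> P a)"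
  using assms by (cases "a \<in> I") (simp_all add: sum.remove[of I a] del: sum_of_bool_eq)

lemma fcost_split:
  assumes a: "a < m" and fin: "finite I" "finite K"
  shows "fcost n m F I K = cost n m (F a) (inner n m F I a) (outer n m F K a) + frest n m F I K a"
proof -
  let ?M = "{..<m} - {a}"
  let ?g = "\<lambda>i j. of_bool (corner n j \<in> F i \<and> corner n i \<notin> F j) :: nat"
  have M: "finite {..<m}" "a \<in> {..<m}" using a by auto
  have "(\<Sum>i<m. \<Sum>j<m. ?g i j) = (\<Sum>j<m. ?g a j) + (\<Sum>i\<in>?M. \<Sum>j<m. ?g i j)"
    by (rule sum.remove[OF M])
  \<comment> \<open>The diagonal term \<open>?g a a\<close> is zero: no corner is both inside and
    outside \<open>F a\<close>.\<close>
  also have "(\<Sum>j<m. ?g a j) = (\<Sum>j\<in>?M. ?g a j)"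
    by (subst sum.remove[OF M]) simp
  also have "(\<Sum>i\<in>?M. \<Sum>j<m. ?g i j) = (\<Sum>i\<in>?M. ?g i a) + (\<Sum>i\<in>?M. \<Sum>j\<in>?M. ?g i j)"
    by (simp only: sum.remove[OF M] sum.distrib)
  finally have S: "(\<Sum>i<m. \<Sum>j<m. ?g i j)
    = (\<Sum>j\<in>?M. ?g a j) + ((\<Sum>i\<in>?M. ?g i a) + (\<Sum>i\<in>?M. \<Sum>j\<in>?M. ?g i j))" .
  have "card {i \<in> inner n m F I a. corner n i \<notin> F a}
    = card {i \<in> {j \<in> ?M. corner n a \<in> F j}. corner n i \<notin> F a} + of_bool (a \<in> I \<and> corner n a \<notin> F a)"
    unfolding inner_def by (rule card_Collect_Un_singleton) auto
  also have "card {i \<in> {j \<in> ?M. corner n a \<in> F j}. corner n i \<notin> F a} = (\<Sum>i\<in>?M. ?g i a)"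
    by (subst sum_of_bool_card) (auto intro: arg_cong[where f = card])
  finally have i: "card {i \<in> inner n m F I a. corner n i \<notin> F a}
    = (\<Sum>i\<in>?M. ?g i a) + of_bool (a \<in> I \<and> corner n a \<notin> F a)" .
  have "card {i \<in> outer n m F K a. corner n i \<in> F a}
    = card {i \<in> {j \<in> ?M. corner n a \<notin> F j}. corner n i \<in> F a} + of_bool (a \<in> K \<and> corner n a \<in> F a)"
    unfolding outer_def by (rule card_Collect_Un_singleton) auto
  also have "card {i \<in> {j \<in> ?M. corner n a \<notin> F j}. corner n i \<in> F a} = (\<Sum>j\<in>?M. ?g a j)"
    by (subst sum_of_bool_card) (auto intro: arg_cong[where f = card])
  finally have o: "card {i \<in> outer n m F K a. corner n i \<in> F a}
    = (\<Sum>j\<in>?M. ?g a j) + of_bool (a \<in> K \<and> corner n a \<in> F a)" .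
  show ?thesis
    unfolding fcost_def frest_def cost_def S i o
      sum_remove_of_bool[OF fin(1), of "\<lambda>i. corner n i \<notin> F i" a]
      sum_remove_of_bool[OF fin(2), of "\<lambda>i. corner n i \<in> F i" a]
      sum.remove[OF M, of "\<lambda>i. bd n m (F i)"]
    by (simp only: add_ac)
qed

lemma fcost_upd:
  assumes "a < m" "finite I" "finite K"
  shows "fcost n m (F(a := B)) I K
    = cost n m B (inner n m F I a) (outer n m F K a) + frest n m F I K a"
proof -
  \<comment> \<open>None of these quantities reads the value of \<open>F\<close> at
    \<open>a\<close>, so an update changes only the \<open>cost\<close> term.\<close>
  have "inner n m (F(a := B)) I a = inner n m F I a" "outer n m (F(a := B)) K a = outer n m F K a"
    by (auto simp: inner_def outer_def)
  moreover have "frest n m (F(a := B)) I K a = frest n m F I K a"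
    by (simp add: frest_def)
  ultimately show ?thesis using fcost_split[OF assms, of n "F(a := B)"] by simp
qed

section \<open>Replacing and merging copies\<close>

lemma fcost_change_le:
  assumes "a < m" "I \<subseteq> {..<m}" "K \<subseteq> {..<m}" "I \<inter> K = {}"
  shows "fcost n m (F(a := B)) I K + bd n m (F a) \<le> fcost n m F I K + bd n m B
    + card {i. i < m \<and> (corner n i \<in> F a) \<noteq> (corner n i \<in> B)}"
proof -
  have fin: "finite I" "finite K" using assms finite_subset by blast+
  show ?thesis
    using cost_change_le[OF inner_outer[OF assms(1,4), of n F], of n B "F a"]
      fcost_upd[OF assms(1) fin, of n F B] fcost_split[OF assms(1) fin, of n F] by linarith
qed

lemma card_corner_Lex_diff:
  assumes "l \<le> l'"
  shows "card {i. i < m \<and> (corner n i \<in> Lex_inv n m l) \<noteq> (corner n i \<in> Lex_inv n m l')}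
    = corner_count n m l' - corner_count n m l"
proof -
  have "{i. i < m \<and> (corner n i \<in> Lex_inv n m l) \<noteq> (corner n i \<in> Lex_inv n m l')}
    = {corner_count n m l..<corner_count n m l'}"
    using corner_count_mono[OF assms, of n m] corner_count_le[of n m l']
    by (auto simp: corner_in_Lex_inv_iff)
  then show ?thesis by simp
qed

text \<open>The hypothesis of the theorem with its two cases merged: one copy is filled as far as
  possible from the other. Subtraction is truncated.\<close>

definition merge_ineq :: "nat \<Rightarrow> nat \<Rightarrow> bool" where
  "merge_ineq n m \<longleftrightarrow> (\<forall>la lb. 0 < lb \<and> lb \<le> la \<and> la < m ^ n \<longrightarrow>
     bd n m (Lex_inv n m (min (la + lb) (m ^ n))) + bd n m (Lex_inv n m (la + lb - m ^ n))
       + corner_count n m (min (la + lb) (m ^ n)) + corner_count n m lb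
     \<le> bd n m (Lex_inv n m la) + bd n m (Lex_inv n m lb)
       + corner_count n m la + corner_count n m (la + lb - m ^ n))"

text \<open>The induction needs arbitrary disjoint \<open>I\<close> and \<open>K\<close> instead of
  intervals, because the decorations induced by the other copies have no particular shape. The bound
  depends only on the three cardinalities.\<close>

definition lex_optimal :: "nat \<Rightarrow> nat \<Rightarrow> bool" where
  "lex_optimal n m \<longleftrightarrow> (\<forall>A I K. A \<subseteq> vertices n m \<and> I \<subseteq> {..<m} \<and> K \<subseteq> {..<m} \<and> I \<inter> K = {} \<longrightarrow>
     lexcost n m (card A) (card I) (card K) \<le> cost n m A I K)"

text \<open>The relabelling \<open>p\<close> is adapted to the decoration of copy \<open>a\<close>;
  with it the relabelled segment attains the lower bound that \<open>lex_optimal\<close> gives for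
  every set of that size.\<close>

lemma compress_copy:
  assumes opt: "lex_optimal n m" and a: "a < m" and F: "F a \<subseteq> vertices n m"
    and IK: "I \<subseteq> {..<m}" "K \<subseteq> {..<m}" "I \<inter> K = {}"
  obtains p where "bij_betw p {..<m} {..<m}"
    "fcost n m (F(a := map p ` Lex_inv n m (card (F a)))) I K \<le> fcost n m F I K"
proof -
  let ?I = "inner n m F I a" and ?K = "outer n m F K a"
  have fin: "finite I" "finite K" using IK finite_subset by blast+
  note io = inner_outer[OF a IK(3), of n F]
  obtain p where p: "bij_betw p {..<m} {..<m}" "p ` {..<card ?I} = ?I" "p ` {m - card ?K..<m} = ?K"
    using exists_relabelling[of ?I m ?K] io by blast
  have "card ?I \<le> m" "card ?K \<le> m" using card_mono[of "{..<m}"] io by fastforce+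
  then have "cost n m (map p ` Lex_inv n m (card (F a))) ?I ?K
      = lexcost n m (card (F a)) (card ?I) (card ?K)"
    using cost_Lex_map[OF p(1), of "card ?I" "card ?K"] p by simp
  also have "\<dots> \<le> cost n m (F a) ?I ?K"
    using opt F io unfolding lex_optimal_def by blast
  finally show ?thesis
    using that[OF p(1)] fcost_upd[OF a fin] fcost_split[OF a fin, of n F] by simp
qed

lemma card_map_Lex_inv:
  assumes "bij_betw p {..<m} {..<m}" "l \<le> m ^ n"
  shows "card (map p ` Lex_inv n m l) = l"
  using card_image[OF inj_on_subset[OF inj_on_map_vertices[OF bij_betw_imp_inj_on[OF assms(1)]]
    Lex_inv_subset]] card_Lex_inv[OF assms(2)] by simp

lemma map_Lex_inv_subset:
  "bij_betw p {..<m} {..<m} \<Longrightarrow> map p ` Lex_inv n m l \<subseteq> vertices n m"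
  using vertices_map Lex_inv_subset by blast

text \<open>Copy \<open>b\<close> shrinks first and copy \<open>a\<close> grows afterwards. Each
  keeps its own relabelling, so old and new contents are nested and the number of affected corners
  is a difference of corner counts. \<open>merge_ineq\<close> pays for both differences.\<close>

lemma merge_copies:
  assumes mrg: "merge_ineq n m" and ab: "a < m" "b < m" "a \<noteq> b"
    and p: "bij_betw p {..<m} {..<m}" "bij_betw p' {..<m} {..<m}"
    and Fa: "F a = map p ` Lex_inv n m la" and Fb: "F b = map p' ` Lex_inv n m lb"
    and l: "0 < lb" "lb \<le> la" "la < m ^ n"
    and IK: "I \<subseteq> {..<m}" "K \<subseteq> {..<m}" "I \<inter> K = {}"
  shows "fcost n m (F(b := map p' ` Lex_inv n m (la + lb - m ^ n),
    a := map p ` Lex_inv n m (min (la + lb) (m ^ n)))) I K \<le> fcost n m F I K"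
proof -
  let ?la = "min (la + lb) (m ^ n)" and ?lb = "la + lb - m ^ n"
  let ?c = "corner_count n m"
  let ?F = "F(b := map p' ` Lex_inv n m ?lb)"
  have le: "?lb \<le> lb" "la \<le> ?la" using l by auto
  have "card {i. i < m \<and> (corner n i \<in> F b) \<noteq> (corner n i \<in> map p' ` Lex_inv n m ?lb)}
    = card {i. i < m \<and> (corner n i \<in> Lex_inv n m lb) \<noteq> (corner n i \<in> Lex_inv n m ?lb)}"
    unfolding Fb by (rule card_corner_map[OF p(2) Lex_inv_subset Lex_inv_subset])
  also have "\<dots> = card {i. i < m \<and> (corner n i \<in> Lex_inv n m ?lb) \<noteq> (corner n i \<in> Lex_inv n m lb)}"
    by (rule arg_cong[where f = card]) auto
  also have "\<dots> = ?c lb - ?c ?lb" by (rule card_corner_Lex_diff[OF le(1)])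
  finally have 1: "fcost n m ?F I K + bd n m (Lex_inv n m lb)
    \<le> fcost n m F I K + bd n m (Lex_inv n m ?lb) + (?c lb - ?c ?lb)"
    using fcost_change_le[OF ab(2) IK, of n F "map p' ` Lex_inv n m ?lb"]
    by (simp add: Fb bd_map[OF p(2) Lex_inv_subset])
  have Fa': "?F a = map p ` Lex_inv n m la" using ab Fa by simp
  have "card {i. i < m \<and> (corner n i \<in> ?F a) \<noteq> (corner n i \<in> map p ` Lex_inv n m ?la)}
    = card {i. i < m \<and> (corner n i \<in> Lex_inv n m la) \<noteq> (corner n i \<in> Lex_inv n m ?la)}"
    unfolding Fa' by (rule card_corner_map[OF p(1) Lex_inv_subset Lex_inv_subset])
  also have "\<dots> = ?c ?la - ?c la" by (rule card_corner_Lex_diff[OF le(2)])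
  finally have 2: "fcost n m (?F(a := map p ` Lex_inv n m ?la)) I K + bd n m (Lex_inv n m la)
    \<le> fcost n m ?F I K + bd n m (Lex_inv n m ?la) + (?c ?la - ?c la)"
    using fcost_change_le[OF ab(1) IK, of n ?F "map p ` Lex_inv n m ?la"]
    unfolding Fa' bd_map[OF p(1) Lex_inv_subset] by linarith
  have "?c ?lb \<le> ?c lb" "?c la \<le> ?c ?la" using corner_count_mono le by blast+
  moreover have "bd n m (Lex_inv n m ?la) + bd n m (Lex_inv n m ?lb) + ?c ?la + ?c lb
     \<le> bd n m (Lex_inv n m la) + bd n m (Lex_inv n m lb) + ?c la + ?c ?lb"
    using mrg l unfolding merge_ineq_def by blast
  ultimately show ?thesis using 1 2 by linarith
qed

section \<open>Reduction to at most one partially filled copy\<close>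

definition partial :: "nat \<Rightarrow> nat \<Rightarrow> (nat \<Rightarrow> nat list set) \<Rightarrow> nat set" where
  "partial n m F = {i. i < m \<and> F i \<noteq> {} \<and> F i \<noteq> vertices n m}"

lemma finite_partial: "finite (partial n m F)"
  by (simp add: partial_def)

lemma sum_card_upd2:
  fixes a b m :: nat and F :: "nat \<Rightarrow> nat list set"
  assumes "a < m" "b < m" "a \<noteq> b" "card A + card B = card (F a) + card (F b)"
  shows "(\<Sum>i<m. card ((F(b := B, a := A)) i)) = (\<Sum>i<m. card (F i))"
proof -
  have "(\<Sum>i<m. card (G i)) = card (G a) + (card (G b) + (\<Sum>i\<in>{..<m} - {a} - {b}. card (G i)))"
    for G :: "nat \<Rightarrow> nat list set"
    using assms by (subst sum.remove[of _ a], simp, simp, subst sum.remove[of _ b]) auto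
  from this[of "F(b := B, a := A)"] this[of F] show ?thesis using assms by simp
qed

text \<open>Strong induction on the number of partial copies: a merge leaves at least one of the two
  copies full or empty and touches no third one.\<close>

lemma reduce_partial:
  assumes opt: "lex_optimal n m" and mrg: "merge_ineq n m"
    and IK: "I \<subseteq> {..<m}" "K \<subseteq> {..<m}" "I \<inter> K = {}"
    and F: "\<forall>i<m. F i \<subseteq> vertices n m"
  shows "\<exists>F'. (\<forall>i<m. F' i \<subseteq> vertices n m) \<and> (\<Sum>i<m. card (F' i)) = (\<Sum>i<m. card (F i)) \<and>
    fcost n m F' I K \<le> fcost n m F I K \<and> card (partial n m F') \<le> 1"
  using F
proof (induction "card (partial n m F)" arbitrary: F rule: less_induct)
  case less
  show ?case
  proof (cases "card (partial n m F) \<le> 1")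
    case True
    then show ?thesis using less.prems by blast
  next
    case False
    then obtain c d where cd: "c \<in> partial n m F" "d \<in> partial n m F" "c \<noteq> d"
      using card_le_Suc0_iff_eq[OF finite_partial, of n m F] by auto
    obtain a b where ab: "a \<in> partial n m F" "b \<in> partial n m F" "a \<noteq> b" "card (F b) \<le> card (F a)"
    proof (cases "card (F d) \<le> card (F c)")
      case True then show ?thesis using cd that by blast
    next
      case False then show ?thesis using cd that[of d c] by simp
    qed
    then have abm: "a < m" "b < m" by (auto simp: partial_def)
    let ?la = "card (F a)" and ?lb = "card (F b)" and ?N = "m ^ n"
    have sub: "F a \<subseteq> vertices n m" "F b \<subseteq> vertices n m" using less.prems abm by auto
    have lN: "?la < ?N"
      using psubset_card_mono[OF finite_vertices, of "F a" n m] sub ab card_vertices[of n m]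
      by (auto simp: partial_def)
    have lb0: "0 < ?lb"
      using finite_subset[OF sub(2) finite_vertices] ab by (auto simp: partial_def card_gt_0_iff)
    obtain p where p: "bij_betw p {..<m} {..<m}"
      "fcost n m (F(a := map p ` Lex_inv n m ?la)) I K \<le> fcost n m F I K"
      using compress_copy[where F = F, OF opt abm(1) sub(1) IK] by blast
    let ?F1 = "F(a := map p ` Lex_inv n m ?la)"
    have b1: "?F1 b = F b" using ab by simp
    \<comment> \<open>Copy \<open>a\<close> has already changed here, so the decoration of
      \<open>b\<close>, and with it \<open>p'\<close>, is taken in the updated family.\<close>
    obtain p' where p': "bij_betw p' {..<m} {..<m}"
      "fcost n m (?F1(b := map p' ` Lex_inv n m ?lb)) I K \<le> fcost n m ?F1 I K"
      using compress_copy[where F = ?F1, OF opt abm(2) _ IK] sub(2) unfolding b1 by blast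
    let ?F2 = "?F1(b := map p' ` Lex_inv n m ?lb)"
    let ?A = "map p ` Lex_inv n m (min (?la + ?lb) ?N)" and ?B = "map p' ` Lex_inv n m (?la + ?lb - ?N)"
    let ?F3 = "?F2(b := ?B, a := ?A)"
    \<comment> \<open>The merge overwrites both compressed copies, so the result differs from
      \<open>F\<close> only at \<open>a\<close> and \<open>b\<close>.\<close>
    have F3: "?F3 = F(b := ?B, a := ?A)" using ab by auto
    have "fcost n m ?F3 I K \<le> fcost n m ?F2 I K"
      by (rule merge_copies[OF mrg abm ab(3) p(1) p'(1)]) (use ab lb0 lN IK in auto)
    then have le: "fcost n m ?F3 I K \<le> fcost n m F I K" using p(2) p'(2) by linarith
    have sub3: "\<forall>i<m. ?F3 i \<subseteq> vertices n m"
      using less.prems map_Lex_inv_subset[OF p(1)] map_Lex_inv_subset[OF p'(1)] ab unfolding F3 by auto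
    have "card ?A = min (?la + ?lb) ?N" by (rule card_map_Lex_inv[OF p(1)]) simp
    moreover have "card ?B = ?la + ?lb - ?N" by (rule card_map_Lex_inv[OF p'(1)]) (use lN ab in simp)
    ultimately have "card ?A + card ?B = ?la + ?lb" by simp
    then have sum3: "(\<Sum>i<m. card (?F3 i)) = (\<Sum>i<m. card (F i))"
      unfolding F3 by (rule sum_card_upd2[OF abm ab(3)])
    \<comment> \<open>Without overflow the level left for \<open>b\<close> is truncated to 0;
      otherwise \<open>a\<close> is filled completely.\<close>
    have "?B = {} \<or> ?A = vertices n m"
    proof (cases "?la + ?lb \<le> ?N")
      case False
      then show ?thesis using vertices_map[OF p(1)] by (simp add: Lex_inv_full)
    qed simp
    then have "a \<notin> partial n m ?F3 \<or> b \<notin> partial n m ?F3" using ab(3) unfolding F3 by (auto simp: partial_def)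
    moreover have "partial n m ?F3 \<subseteq> partial n m F" using ab(1,2) unfolding F3 by (auto simp: partial_def)
    ultimately have "partial n m ?F3 \<subset> partial n m F" using ab(1,2) by blast
    then have "card (partial n m ?F3) < card (partial n m F)"
      by (rule psubset_card_mono[OF finite_partial])
    from less.hyps[OF this sub3] show ?thesis
      unfolding sum3 by (elim ex_forward conj_forward) (assumption | erule order.trans[OF _ le])+
  qed
qed

section \<open>Optimality of lexicographic segments\<close>

text \<open>\<open>P\<close> holds the full copies other than \<open>a\<close>. A full and an empty
  copy are joined by one boundary edge, which gives the product; \<open>card (I - P - {a})\<close>
  counts empty copies whose exterior neighbour is inside, and \<open>card (K \<inter> P)\<close>
  full copies whose exterior neighbour is outside.\<close>

lemma fcost_blocks:
  assumes m: "a < m" and fin: "finite I" "finite K" and P: "P \<subseteq> {..<m} - {a}"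
    and F: "\<And>i. i < m \<Longrightarrow> i \<noteq> a \<Longrightarrow> F i = (if i \<in> P then vertices n m else {})"
    and IK: "I \<subseteq> {..<m}" "K \<subseteq> {..<m}"
  shows "fcost n m F I K
    = cost n m (F a) (P \<union> I \<inter> {a}) (({..<m} - {a} - P) \<union> K \<inter> {a})
      + card P * (m - 1 - card P) + card (I - P - {a}) + card (K \<inter> P)"
proof -
  let ?M = "{..<m} - {a}"
  have c: "corner n j \<in> F i \<longleftrightarrow> i \<in> P" if "i \<in> ?M" "j < m" for i j
    using that F corner_in_vertices by simp
  have finP: "finite P" using P finite_subset by blast
  have "inner n m F I a = P \<union> I \<inter> {a}" "outer n m F K a = (?M - P) \<union> K \<inter> {a}"
    using c[of _ a] P m by (auto simp: inner_def outer_def)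
  moreover have "frest n m F I K a = card P * (m - 1 - card P) + card (I - P - {a}) + card (K \<inter> P)"
  proof -
    have "(\<Sum>i\<in>?M. bd n m (F i)) = 0"
      using F by (intro sum.neutral) auto
    moreover have "(\<Sum>i\<in>?M. \<Sum>j\<in>?M. of_bool (corner n j \<in> F i \<and> corner n i \<notin> F j) :: nat)
      = (\<Sum>i\<in>?M. \<Sum>j\<in>?M. of_bool (i \<in> P) * of_bool (j \<notin> P))"
      using c by (intro sum.cong refl) auto
    moreover have "\<dots> = (\<Sum>i\<in>?M. of_bool (i \<in> P)) * (\<Sum>j\<in>?M. of_bool (j \<notin> P))"
      by (rule sum_product[symmetric])
    moreover have "(\<Sum>i\<in>?M. of_bool (i \<in> P) :: nat) = card P"
      using P by (subst sum_of_bool_card) (auto intro: arg_cong[where f = card])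
    moreover have "(\<Sum>j\<in>?M. of_bool (j \<notin> P) :: nat) = m - 1 - card P"
    proof -
      have "{j \<in> ?M. j \<notin> P} = ?M - P" by auto
      then show ?thesis using P finP m by (subst sum_of_bool_card) (simp_all add: card_Diff_subset)
    qed
    moreover have "(\<Sum>i\<in>I - {a}. of_bool (corner n i \<notin> F i) :: nat) = card (I - P - {a})"
    proof -
      have "{i \<in> I - {a}. corner n i \<notin> F i} = I - P - {a}" using c IK by auto
      then show ?thesis using fin by (subst sum_of_bool_card) simp_all
    qed
    moreover have "(\<Sum>i\<in>K - {a}. of_bool (corner n i \<in> F i) :: nat) = card (K \<inter> P)"
    proof -
      have "{i \<in> K - {a}. corner n i \<in> F i} = K \<inter> P" using c IK P by (auto simp: subset_iff)
      then show ?thesis using fin by (subst sum_of_bool_card) simp_all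
    qed
    ultimately show ?thesis by (simp only: frest_def)
  qed
  ultimately show ?thesis using fcost_split[OF m fin, of n F] by simp
qed

lemma section_Lex_inv_blocks:
  assumes "i < m" "r < m ^ n"
  shows "section_at (Lex_inv (Suc n) m (p * m ^ n + r)) i
    = (if i < p then vertices n m else if i = p then Lex_inv n m r else {})"
proof -
  consider "i < p" | "i = p" | "p < i" by linarith
  then show ?thesis
  proof cases
    case 1
    then have "Suc i * m ^ n \<le> p * m ^ n" by (intro mult_right_mono) auto
    then show ?thesis using 1 assms by (simp add: section_Lex_inv Lex_inv_full)
  next
    case 2
    then show ?thesis using assms by (simp add: section_Lex_inv)
  next
    case 3
    then have "Suc p * m ^ n \<le> i * m ^ n" by (intro mult_right_mono) auto
    then show ?thesis using 3 assms by (simp add: section_Lex_inv)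
  qed
qed

text \<open>The full copies \<open>i < p\<close> contribute their corner \<open>i\<close>. Copy
  \<open>p\<close> contributes its own exactly when \<open>corner n p\<close> lies in the segment of
  size \<open>r\<close>; later copies are empty.\<close>

lemma corner_count_Suc:
  assumes "p < m" "r < m ^ n"
  shows "corner_count (Suc n) m (p * m ^ n + r) = p + of_bool (p < corner_count n m r)"
proof -
  let ?L = "Lex_inv (Suc n) m (p * m ^ n + r)"
  have "corner_count (Suc n) m (p * m ^ n + r) = card {i. i < m \<and> corner (Suc n) i \<in> ?L}"
    unfolding corner_count_def by (auto simp: Lex_inv_def corner_in_vertices intro: arg_cong[where f = card])
  also have "{i. i < m \<and> corner (Suc n) i \<in> ?L} = {i. i < m \<and> corner n i \<in> section_at ?L i}"
    by (auto simp: corner_Suc section_at_def)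
  also have "\<dots> = {..<p} \<union> (if p < corner_count n m r then {p} else {})"
    using assms by (auto simp: section_Lex_inv_blocks corner_in_vertices corner_in_Lex_inv_iff
      split: if_splits)
  finally show ?thesis by simp
qed

lemma cost_Lex_inv:
  assumes "s \<le> m" "k \<le> m"
  shows "cost n m (Lex_inv n m l) {..<s} {m - k..<m} = lexcost n m l s k"
  using cost_Lex_map[of id m s k n l] assms by simp

lemma bd_Lex_inv_Suc:
  assumes "p < m" "r < m ^ n"
  shows "bd (Suc n) m (Lex_inv (Suc n) m (p * m ^ n + r))
    = bd n m (Lex_inv n m r) + p * (m - 1 - p) + (p - corner_count n m r) + (corner_count n m r - (p + 1))"
proof -
  let ?L = "Lex_inv (Suc n) m (p * m ^ n + r)"
  let ?F = "section_at ?L"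
  have Fp: "?F p = Lex_inv n m r" using assms by (simp add: section_Lex_inv_blocks)
  have "bd (Suc n) m ?L = fcost n m ?F {} {}"
    using cost_Suc[OF Lex_inv_subset, of "{}" "{}"] by (simp add: cost_def)
  also have "\<dots> = cost n m (?F p) ({..<p} \<union> {} \<inter> {p}) (({..<m} - {p} - {..<p}) \<union> {} \<inter> {p})
      + card {..<p} * (m - 1 - card {..<p}) + card ({} - {..<p} - {p}) + card ({} \<inter> {..<p})"
    by (rule fcost_blocks) (use assms in \<open>auto simp: section_Lex_inv_blocks\<close>)
  also have "{..<p} \<union> {} \<inter> {p} = {..<p}" by simp
  \<comment> \<open>The empty copies are the last \<open>m - 1 - p\<close> ones; in this form the
    decoration of copy \<open>p\<close> fits \<open>cost_Lex_inv\<close>.\<close>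
  also have "({..<m} - {p} - {..<p}) \<union> {} \<inter> {p} = {m - (m - 1 - p)..<m}" using assms by auto
  finally show ?thesis
    using assms corner_count_le[of n m r] cost_Lex_inv[of p m "m - 1 - p" n r]
    by (simp add: Fp lexcost_def)
qed

lemma lexcost_full: "s \<le> m \<Longrightarrow> lexcost n m (m ^ n) s k = k"
  by (simp add: lexcost_def Lex_inv_full corner_count_full)

text \<open>Compares the corner terms of two arrangements with \<open>p\<close> full copies, the
  lexicographic one on the left. \<open>s\<close> and \<open>k\<close> are the sizes of
  \<open>I\<close> and \<open>K\<close>, \<open>Q\<close> counts the corners in the segment of the
  remaining copy, \<open>x\<close> and \<open>y\<close> count the cut exterior edges at empty and at
  full copies, and \<open>e\<close> and \<open>f\<close> say whether the index of the remaining copy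
  lies in \<open>I\<close> or in \<open>K\<close>.\<close>

lemma block_arith:
  fixes s k p Q m x y e f :: nat
  assumes "s \<le> x + p + e" "k \<le> y + (m - 1 - p) + f" "e + f \<le> 1" "p < m" "Q \<le> m"
  shows "(p - Q) + (Q - (p + 1)) + (s - (p + of_bool (p < Q))) + (p + of_bool (p < Q) + k - m)
    \<le> (p + e - Q) + (Q + (m - 1 - p + f) - m) + x + y"
\<comment> \<open>\<open>p < Q\<close> says that the lexicographic arrangement has its corner
  \<open>p\<close> inside. An extra exterior edge cut on the left is then paid for by
  \<open>f\<close>, and in the other case by \<open>e\<close>.\<close>
proof (cases "p < Q")
  case True
  have "s - (p + 1) \<le> x" "p + 1 + k - m \<le> y + f" using assms by linarith+
  moreover have "Q + (m - 1 - p + f) - m = Q - (p + 1) + f" using True assms by linarith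
  moreover have "p - Q = 0" "of_bool (p < Q) = (1 :: nat)" using True by auto
  ultimately show ?thesis by linarith
next
  case False
  have "s - p \<le> x + e" "p + k - m \<le> y" using assms by linarith+
  moreover have "p + e - Q = p - Q + e" "Q - (p + 1) = 0" using False by linarith+
  ultimately show ?thesis using False by simp
qed

text \<open>With one copy not full and all others full or empty, the size is that of a segment with
  as many full copies. Once the exceptional copy is bounded by \<open>lex_optimal\<close>, both
  arrangements share its \<open>bd\<close> term and the edges between full and empty copies;
  \<open>block_arith\<close> settles the rest.\<close>

lemma fcost_lower_bound:
  assumes opt: "lex_optimal n m" and m: "m \<ge> 1"
    and IK: "I \<subseteq> {..<m}" "K \<subseteq> {..<m}" "I \<inter> K = {}"
    and F: "\<forall>i<m. F i \<subseteq> vertices n m" and part: "card (partial n m F) \<le> 1"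
  shows "lexcost (Suc n) m (\<Sum>i<m. card (F i)) (card I) (card K) \<le> fcost n m F I K"
\<comment> \<open>The case of only full copies is treated apart: the block formulas need a remaining
  copy with fewer than \<open>m ^ n\<close> vertices.\<close>
proof (cases "\<forall>i<m. F i = vertices n m")
  case True
  have fin: "finite I" "finite K" using IK finite_subset by blast+
  have "card I \<le> m" using card_mono[of "{..<m}" I] IK by simp
  moreover have "(\<Sum>i<m. card (F i)) = m ^ Suc n"
    using True by (simp add: card_vertices)
  moreover have "(\<Sum>i\<in>K. of_bool (corner n i \<in> F i) :: nat) = (\<Sum>i\<in>K. 1)"
    using True IK corner_in_vertices by (intro sum.cong refl) auto
  ultimately show ?thesis by (simp only: lexcost_full fcost_def) simp
next
  case False
  have fin: "finite I" "finite K" using IK finite_subset by blast+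
  \<comment> \<open>\<open>a\<close> is the partial copy if there is one, and otherwise some copy
    that is not full.\<close>
  obtain a where a: "a < m" "F a \<noteq> vertices n m" "\<And>i. i < m \<Longrightarrow> i \<noteq> a \<Longrightarrow> i \<notin> partial n m F"
  proof (cases "partial n m F = {}")
    case True then show ?thesis using False that by blast
  next
    case False
    then obtain a where "a \<in> partial n m F" by blast
    moreover have "i = j" if "i \<in> partial n m F" "j \<in> partial n m F" for i j
      using part that card_le_Suc0_iff_eq[OF finite_partial, of n m F] by simp
    ultimately show ?thesis using that[of a] by (auto simp: partial_def)
  qed
  define P where "P = {i \<in> {..<m} - {a}. F i = vertices n m}"
  define r where "r = card (F a)"
  let ?p = "card P" and ?Q = "corner_count n m r" and ?N = "m ^ n"
  have P: "P \<subseteq> {..<m} - {a}" and finP: "finite P" by (auto simp: P_def)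
  have FP: "F i = (if i \<in> P then vertices n m else {})" if "i < m" "i \<noteq> a" for i
    using a(3)[OF that] that by (auto simp: P_def partial_def)
  have rN: "r < ?N"
    using psubset_card_mono[OF finite_vertices, of "F a" n m] F a card_vertices[of n m]
    by (auto simp: r_def)
  have pm: "?p \<le> m - 1" using card_mono[OF _ P] a by simp
  then have pm': "?p < m" using m by simp
  have "(\<Sum>i<m. card (F i)) = r + (\<Sum>i\<in>{..<m} - {a}. card (F i))"
    unfolding r_def using a by (intro sum.remove) auto
  also have "(\<Sum>i\<in>{..<m} - {a}. card (F i)) = (\<Sum>i\<in>{..<m} - {a}. if i \<in> P then ?N else 0)"
    using FP by (intro sum.cong) (auto simp: card_vertices)
  also have "\<dots> = (\<Sum>i\<in>P. ?N)"
    using P by (simp add: sum.inter_restrict[symmetric] Int_absorb1)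
  finally have l: "(\<Sum>i<m. card (F i)) = ?p * ?N + r" by simp
  let ?I = "P \<union> I \<inter> {a}" and ?K = "({..<m} - {a} - P) \<union> K \<inter> {a}"
  have io: "?I \<subseteq> {..<m}" "?K \<subseteq> {..<m}" "?I \<inter> ?K = {}" using a P IK by auto
  have cI: "card ?I = ?p + of_bool (a \<in> I)" using P finP by (auto simp: card_insert_if)
  have "card ({..<m} - {a} - P) = m - 1 - ?p" using P finP a by (simp add: card_Diff_subset)
  then have cK: "card ?K = m - 1 - ?p + of_bool (a \<in> K)" by (auto simp: card_insert_if)
  have c: "fcost n m F I K \<ge> lexcost n m r (card ?I) (card ?K)
    + ?p * (m - 1 - ?p) + card (I - P - {a}) + card (K \<inter> P)"
  proof -
    have "lexcost n m r (card ?I) (card ?K) \<le> cost n m (F a) ?I ?K"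
      using opt F a(1) io unfolding lex_optimal_def r_def by blast
    then show ?thesis using fcost_blocks[of a m I K P F n, OF a(1) fin P FP IK(1,2)] by linarith
  qed
  \<comment> \<open>An index of \<open>I\<close> names a full copy, is \<open>a\<close>, or names an
    empty copy whose exterior edge is cut.\<close>
  have bI: "card I \<le> card (I - P - {a}) + ?p + of_bool (a \<in> I)"
  proof -
    have "I \<subseteq> (I - P - {a}) \<union> ?I" by auto
    then have "card I \<le> card ((I - P - {a}) \<union> ?I)" using fin finP by (intro card_mono) auto
    then show ?thesis using card_Un_le[of "I - P - {a}" ?I] cI by linarith
  qed
  have bK: "card K \<le> card (K \<inter> P) + (m - 1 - ?p) + of_bool (a \<in> K)"
  proof -
    have "K \<subseteq> (K \<inter> P) \<union> ?K" using IK by auto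
    then have "card K \<le> card ((K \<inter> P) \<union> ?K)" using fin finP by (intro card_mono) auto
    then show ?thesis using card_Un_le[of "K \<inter> P" ?K] cK by linarith
  qed
  have Qm: "?Q \<le> m" by (rule corner_count_le)
  have disj: "of_bool (a \<in> I) + of_bool (a \<in> K) \<le> (1 :: nat)" using IK by auto
  show ?thesis
    using c block_arith[OF bI bK disj pm' Qm]
    unfolding l lexcost_def corner_count_Suc[OF pm' rN] bd_Lex_inv_Suc[OF pm' rN] cI cK
    by linarith
qed

section \<open>Induction on the word length\<close>

lemma lex_optimal_0: "lex_optimal 0 m"
  unfolding lex_optimal_def
proof (intro allI impI, elim conjE)
  fix A I K assume A: "A \<subseteq> vertices 0 m" and IK: "I \<subseteq> {..<m}" "K \<subseteq> {..<m}"
  \<comment> \<open>For \<open>n = 0\<close> the graph is one vertex that is every corner at once,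
    so only the empty and the full set occur.\<close>
  have V: "vertices 0 m = {[]}" by (auto simp: vertices_def)
  have le: "card I \<le> m" "card K \<le> m" using card_mono[of "{..<m}"] IK by fastforce+
  consider "A = {}" | "A = vertices 0 m" using A unfolding V by blast
  then show "lexcost 0 m (card A) (card I) (card K) \<le> cost 0 m A I K"
  proof cases
    case 1
    then show ?thesis using le by (simp add: lexcost_def cost_def corner_count_0)
  next
    case 2
    then have "cost 0 m A I K = card K" using bd_vertices[of 0 m] by (simp add: cost_def V corner_def)
    then show ?thesis using lexcost_full[OF le(1), of 0 "card K"] 2 card_vertices[of 0 m] by simp
  qed
qed

lemma lex_optimal_Suc:
  assumes "lex_optimal n m" "merge_ineq n m" "m \<ge> 1"
  shows "lex_optimal (Suc n) m"
  unfolding lex_optimal_def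
proof (intro allI impI, elim conjE)
  fix A I K assume A: "A \<subseteq> vertices (Suc n) m" and IK: "I \<subseteq> {..<m}" "K \<subseteq> {..<m}" "I \<inter> K = {}"
  have fin: "finite I" "finite K" using IK finite_subset by blast+
  have "\<forall>i<m. section_at A i \<subseteq> vertices n m" using section_at_subset[OF A] by blast
  from reduce_partial[OF assms(1,2) IK this] obtain F where F: "\<forall>i<m. F i \<subseteq> vertices n m"
    "(\<Sum>i<m. card (F i)) = card A" "fcost n m F I K \<le> cost (Suc n) m A I K"
    "card (partial n m F) \<le> 1"
    unfolding cost_Suc[OF A fin] card_by_sections[OF A] by blast
  show "lexcost (Suc n) m (card A) (card I) (card K) \<le> cost (Suc n) m A I K"
    using fcost_lower_bound[OF assms(1,3) IK F(1,4)] F(2,3) by simp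
qed

lemma lex_optimal:
  assumes "m \<ge> 1" "\<And>n. n \<ge> 1 \<Longrightarrow> merge_ineq n m"
  shows "lex_optimal n m"
proof (induction n)
  case 0
  show ?case by (rule lex_optimal_0)
next
  case (Suc n)
  have "merge_ineq n m"
  proof (cases "n = 0")
    case True
    \<comment> \<open>\<open>m ^ 0 = 1\<close> leaves no \<open>la\<close> with
      \<open>0 < lb \<le> la < 1\<close>, so the inequality is vacuous.\<close>
    then show ?thesis by (simp add: merge_ineq_def)
  next
    case False
    then show ?thesis using assms(2) by simp
  qed
  then show ?case using Suc assms(1) by (intro lex_optimal_Suc)
qed

section \<open>Transfer to the decorated graph\<close>

lemma card_dec_Theta:
  assumes S: "S \<subseteq> vertices n m"
  shows "card (dec_Theta n m s t S) = cost n m S {..<s} {s + t..<m}"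
proof -
  let ?X = "Inl ` S \<union> Inr ` {..<s} :: (nat list + nat) set"
  let ?e = "\<lambda>i. {Inr i, Inl (corner n i)} :: (nat list + nat) set"
  have X: "Inl v \<in> ?X \<longleftrightarrow> v \<in> S" "Inr i \<in> ?X \<longleftrightarrow> i < s" for v i by auto
  have inner_edge: "card (Inl ` e \<inter> ?X) = card (e \<inter> S)" for e
  proof -
    have "Inl ` e \<inter> ?X = Inl ` (e \<inter> S)" by auto
    then show ?thesis by (simp add: card_image)
  qed
  \<comment> \<open>The exterior vertex of an index below \<open>s\<close> counts as inside and any
    other as outside, so its edge is cut when the corner lies on the other side.\<close>
  have outer_edge: "card (?e i \<inter> ?X) = 1 \<longleftrightarrow> (i < s) \<noteq> (corner n i \<in> S)" for i
    using card_doubleton_Int_eq_1[of "Inr i" "Inl (corner n i)" ?X] X by blast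
  let ?I = "{i \<in> {..<s}. corner n i \<notin> S}" and ?K = "{i \<in> {s + t..<m}. corner n i \<in> S}"
  have "dec_Theta n m s t S = image Inl ` Theta n m S \<union> ?e ` (?I \<union> ?K)" (is "?L = ?R")
  proof (intro equalityI subsetI)
    fix x assume "x \<in> ?L"
    then have x: "x \<in> dec_edges n m s t" "card (x \<inter> ?X) = 1"
      by (auto simp: dec_Theta_def edge_boundary_def I_set_def)
    then consider e where "e \<in> edges n m" "x = Inl ` e" | i where "i < s \<or> s + t \<le> i \<and> i < m" "x = ?e i"
      by (auto simp: dec_edges_def I_set_def K_set_def)
    then show "x \<in> ?R"
    proof cases
      case 1
      then have "e \<in> Theta n m S" using x(2) inner_edge[of e]
        by (simp add: Theta_def edge_boundary_def)
      then show ?thesis using 1 by blast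
    next
      case 2
      then have "i \<in> ?I \<union> ?K" using x(2) outer_edge[of i] by auto
      then show ?thesis using 2 by blast
    qed
  next
    fix x assume "x \<in> ?R"
    then consider e where "e \<in> Theta n m S" "x = Inl ` e" | i where "i \<in> ?I \<union> ?K" "x = ?e i"
      by blast
    then show "x \<in> ?L"
    proof cases
      case 1
      then have "e \<in> edges n m" "card (x \<inter> ?X) = 1"
        using inner_edge[of e] by (auto simp: Theta_def edge_boundary_def)
      then show ?thesis using 1 unfolding dec_Theta_def edge_boundary_def dec_edges_def I_set_def by blast
    next
      case 2
      then have "card (x \<inter> ?X) = 1" using outer_edge[of i] by auto
      moreover have "i \<in> I_set s \<union> K_set m s t" using 2 by (auto simp: I_set_def K_set_def)
      ultimately show ?thesis using 2(2)
        unfolding dec_Theta_def edge_boundary_def dec_edges_def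
        by (simp add: I_set_def[of s]) blast
    qed
  qed
  moreover have "finite (Theta n m S)"
  proof -
    have "edges n m \<subseteq> Pow (vertices n m)" by (auto simp: edges_def)
    then have "finite (edges n m)" using finite_vertices finite_subset finite_Pow_iff by metis
    then show ?thesis by (simp add: Theta_def edge_boundary_def)
  qed
  moreover have "image Inl ` Theta n m S \<inter> ?e ` (?I \<union> ?K) = {}" by auto
  moreover have "card (image Inl ` Theta n m S) = card (Theta n m S)"
    by (rule card_image) (auto simp: inj_on_def)
  moreover have "card (?e ` (?I \<union> ?K)) = card (?I \<union> ?K)"
    by (rule card_image) (auto simp: inj_on_def doubleton_eq_iff)
  moreover have "card (?I \<union> ?K) = card ?I + card ?K"
    by (rule card_Un_disjoint) auto
  ultimately show ?thesis
    by (simp add: card_Un_disjoint cost_def card_Theta[OF S])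
qed

text \<open>Moving the counts that \<open>sigma\<close> subtracts to the other side gives an
  inequality between naturals. Below \<open>m ^ n\<close> the remainder vanishes; otherwise one copy
  becomes full, with empty boundary and all \<open>m\<close> corners, which accounts for the
  \<open>m\<close> in \<open>sigma\<close>.\<close>

lemma merge_ineqI:
  assumes n: "n \<ge> 1" and H: "\<And>la lb. m ^ n \<ge> la \<Longrightarrow> la \<ge> lb \<Longrightarrow> lb > 0 \<Longrightarrow>
      (la + lb \<le> m ^ n \<longrightarrow>
         int (card (Theta n m (Lex_inv n m (la + lb)))) + sigma n m la lb
           \<le> int (card (Theta n m (Lex_inv n m la))) + int (card (Theta n m (Lex_inv n m lb)))) \<and>
      (la + lb \<ge> m ^ n \<longrightarrow>
         int (card (Theta n m (Lex_inv n m (la + lb - m ^ n)))) + sigma n m la lb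
           \<le> int (card (Theta n m (Lex_inv n m la))) + int (card (Theta n m (Lex_inv n m lb))))"
  shows "merge_ineq n m"
  unfolding merge_ineq_def
proof (intro allI impI, elim conjE)
  fix la lb assume l: "0 < lb" "lb \<le> la" "la < m ^ n"
  note H' = H[OF less_imp_le[OF l(3)] l(2,1), unfolded sigma_def q_eq_corner_count[OF n]
    card_Theta[OF Lex_inv_subset]]
  show "bd n m (Lex_inv n m (min (la + lb) (m ^ n))) + bd n m (Lex_inv n m (la + lb - m ^ n))
       + corner_count n m (min (la + lb) (m ^ n)) + corner_count n m lb
     \<le> bd n m (Lex_inv n m la) + bd n m (Lex_inv n m lb)
       + corner_count n m la + corner_count n m (la + lb - m ^ n)"
  proof (cases "la + lb < m ^ n")
    case True
    then show ?thesis using H' by (simp add: corner_count_0)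
  next
    case False
    then show ?thesis using H' by (simp add: corner_count_full Lex_inv_full)
  qed
qed

theorem theorem1:
  assumes "\<forall>n m la lb :: nat. n \<ge> 1 \<and> m \<ge> 2 \<and> m ^ n \<ge> la \<and> la \<ge> lb \<and> lb > 0 \<longrightarrow>
      (la + lb \<le> m ^ n \<longrightarrow>
         int (card (Theta n m (Lex_inv n m (la + lb)))) + sigma n m la lb
           \<le> int (card (Theta n m (Lex_inv n m la))) + int (card (Theta n m (Lex_inv n m lb)))) \<and>
      (la + lb \<ge> m ^ n \<longrightarrow>
         int (card (Theta n m (Lex_inv n m (la + lb - m ^ n)))) + sigma n m la lb
           \<le> int (card (Theta n m (Lex_inv n m la))) + int (card (Theta n m (Lex_inv n m lb))))"
  shows "\<forall>n m s t l :: nat. n \<ge> 1 \<and> m \<ge> 2 \<and> s + t \<le> m \<and> l \<le> m ^ n \<longrightarrow>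
      Min {card (dec_Theta n m s t S) | S. S \<subseteq> vertices n m \<and> card S = l}
        = card (dec_Theta n m s t (Lex_inv n m l))"
proof (intro allI impI, elim conjE)
  fix n m s t l :: nat
  assume h: "n \<ge> 1" "m \<ge> 2" "s + t \<le> m" "l \<le> m ^ n"
  have "merge_ineq k m" if "k \<ge> 1" for k
    using merge_ineqI[OF that] assms that h(2) by blast
  then have opt: "lex_optimal n m" using lex_optimal h(2) by simp
  \<comment> \<open>The indices in \<open>K\<close> are the last \<open>k\<close>, so the decoration
    already has the shape evaluated by \<open>lexcost\<close>, without relabelling.\<close>
  define k where "k = m - (s + t)"
  have K: "{s + t..<m} = {m - k..<m}" using h by (simp add: k_def)
  have ck: "card {m - k..<m} = k" by (simp add: k_def)
  have theta: "card (dec_Theta n m s t S) = cost n m S {..<s} {m - k..<m}" if "S \<subseteq> vertices n m" for S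
    using card_dec_Theta[OF that, of s t] K by simp
  have L: "card (dec_Theta n m s t (Lex_inv n m l)) = lexcost n m l s k"
    using theta[OF Lex_inv_subset] cost_Lex_inv[of s m k n l] h(3) by (simp add: k_def)
  show "Min {card (dec_Theta n m s t S) | S. S \<subseteq> vertices n m \<and> card S = l}
        = card (dec_Theta n m s t (Lex_inv n m l))"
  proof (rule Min_eqI)
    have "{card (dec_Theta n m s t S) | S. S \<subseteq> vertices n m \<and> card S = l}
      \<subseteq> (\<lambda>S. card (dec_Theta n m s t S)) ` Pow (vertices n m)" by blast
    then show "finite {card (dec_Theta n m s t S) | S. S \<subseteq> vertices n m \<and> card S = l}"
      using finite_vertices by (meson finite_Pow_iff finite_imageI finite_subset)
    show "card (dec_Theta n m s t (Lex_inv n m l))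
      \<in> {card (dec_Theta n m s t S) | S. S \<subseteq> vertices n m \<and> card S = l}"
      using Lex_inv_subset card_Lex_inv[OF h(4)] by blast
    fix y assume "y \<in> {card (dec_Theta n m s t S) | S. S \<subseteq> vertices n m \<and> card S = l}"
    then obtain S where S: "S \<subseteq> vertices n m" "card S = l" "y = card (dec_Theta n m s t S)" by blast
    have "{..<s} \<subseteq> {..<m}" "{m - k..<m} \<subseteq> {..<m}" "{..<s} \<inter> {m - k..<m} = {}"
      using h(3) by (auto simp: k_def)
    then have "lexcost n m (card S) (card {..<s}) (card {m - k..<m}) \<le> cost n m S {..<s} {m - k..<m}"
      using opt S(1) unfolding lex_optimal_def by blast
    then show "card (dec_Theta n m s t (Lex_inv n m l)) \<le> y"
      using L theta[OF S(1)] S(2,3) ck by simp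
  qed
qed

end
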